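(* The terminal positions satisfy $*L \in \mathcal{L}$ and $*R \in \mathcal{R}$. Moreover, for any non-terminal position $G = \{G_1, \ldots, G_n\}$: (i) there exist $i,j$ with $G_i \in \mathcal{L} \cup \mathcal{P}$ and $G_j \in \mathcal{R} \cup \mathcal{P}$ if and only if $G \in \mathcal{N}$; (ii) there exists $i$ with $G_i \in \mathcal{L}$ and every $G_j \in \mathcal{L} \cup \mathcal{N}$ if and only if $G \in \mathcal{L}$; (iii) there exists $i$ with $G_i \in \mathcal{R}$ and every $G_j \in \mathcal{R} \cup \mathcal{N}$ if and only if $G \in \mathcal{R}$; (iv) every $G_i \in \mathcal{N}$ if and only if $G \in \mathcal{P}$.
   Context: Positions are defined recursively: $*L$ and $*R$ are terminal positions; if $G_1,\dots,G_n$ ($n\ge 1$) are positions, then $G=\{G_1,\dots,G_n\}$ is a position with options $G_1,\dots,G_n$. All positions have finite game trees. Play: two players, Left and Right, move alternately; from a non-terminal position the player to move chooses any option (both players have the same options). When a terminal position is reached the game ends: Left wins if it is $*L$, Right wins if it is $*R$. The outcome class of $G$ is $\mathcal{L}$ if Left has a winning strategy from $G$ whether she moves first or second, $\mathcal{R}$ if Right has a winning strategy whether he moves first or second, $\mathcal{N}$ if the player who moves first has a winning strategy (whoever that is), and $\mathcal{P}$ if the player who moves second has a winning strategy; every position is in exactly one of these classes. *)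

theory Defs
  imports Main "HOL-Library.FSet"
begin

datatype player = Left | Right

fun opponent :: "player \<Rightarrow> player" where
  "opponent Left = Right"
| "opponent Right = Left"

text \<open>The raw type still admits the empty set of options (at any depth); the predicate
  \<open>position\<close> below excludes it. Finiteness of game trees is built into the datatype.\<close>

datatype game = StarL | StarR | Node "game fset"

inductive position :: "game \<Rightarrow> bool" where
  "position StarL"
| "position StarR"
| "Gs \<noteq> {||} \<Longrightarrow> (\<And>H. H |\<in>| Gs \<Longrightarrow> position H) \<Longrightarrow> position (Node Gs)"

fun moves :: "game \<Rightarrow> game fset" where
  "moves StarL = {||}"
| "moves StarR = {||}"
| "moves (Node Gs) = Gs"

fun won_by :: "player \<Rightarrow> game \<Rightarrow> bool" where
  "won_by Left T \<longleftrightarrow> T = StarL"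
| "won_by Right T \<longleftrightarrow> T = StarR"

text \<open>A complete play from \<open>G\<close> is recorded as the list of the successive positions.\<close>

definition complete_play :: "game \<Rightarrow> game list \<Rightarrow> bool" where
  "complete_play G ps \<longleftrightarrow>
     ps \<noteq> [] \<and> hd ps = G \<and> last ps \<in> {StarL, StarR} \<and>
     (\<forall>i. Suc i < length ps \<longrightarrow> ps ! Suc i |\<in>| moves (ps ! i))"

text \<open>The player who makes the move number \<open>i\<close> (counted from 0) when \<open>F\<close> moves first.\<close>

definition mover :: "player \<Rightarrow> nat \<Rightarrow> player" where
  "mover F i = (if even i then F else opponent F)"

text \<open>A strategy of a player prescribes an option at each position in which that player may
  have to move; its values at positions without options are irrelevant.\<close>

type_synonym strategy = "game \<Rightarrow> game"

definition legal_strategy :: "strategy \<Rightarrow> bool" where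
  "legal_strategy \<sigma> \<longleftrightarrow> (\<forall>H. moves H \<noteq> {||} \<longrightarrow> \<sigma> H |\<in>| moves H)"

definition follows :: "player \<Rightarrow> player \<Rightarrow> strategy \<Rightarrow> game list \<Rightarrow> bool" where
  "follows A F \<sigma> ps \<longleftrightarrow>
     (\<forall>i. Suc i < length ps \<and> mover F i = A \<longrightarrow> ps ! Suc i = \<sigma> (ps ! i))"

text \<open>Player \<open>A\<close> has a winning strategy from \<open>G\<close> when player \<open>F\<close> moves first.\<close>

definition has_winning_strategy :: "player \<Rightarrow> player \<Rightarrow> game \<Rightarrow> bool" where
  "has_winning_strategy A F G \<longleftrightarrow>
     (\<exists>\<sigma>. legal_strategy \<sigma> \<and>
        (\<forall>ps. complete_play G ps \<and> follows A F \<sigma> ps \<longrightarrow> won_by A (last ps)))"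

definition outcome_L :: "game set" where
  "outcome_L = {G. position G \<and> (\<forall>F. has_winning_strategy Left F G)}"

definition outcome_R :: "game set" where
  "outcome_R = {G. position G \<and> (\<forall>F. has_winning_strategy Right F G)}"

definition outcome_N :: "game set" where
  "outcome_N = {G. position G \<and> (\<forall>F. has_winning_strategy F F G)}"

definition outcome_P :: "game set" where
  "outcome_P = {G. position G \<and> (\<forall>F. has_winning_strategy (opponent F) F G)}"

end

theory Submission imports Defs begin

text \<open>Backward induction decides which player wins under either choice of first mover. A single
  positional strategy, "move to an option that is won as second player whenever there is one",
  realises every win so predicted; conversely two opposing strategies always produce a common
  complete play, so the players cannot both have winning strategies. Hence
  \<open>has_winning_strategy\<close> obeys the recursion and is determined. By determinacy, the player \<open>A\<close>
  wins moving first exactly on the class of \<open>A\<close> together with \<open>\<N>\<close>, and moving second exactly on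
  the class of \<open>A\<close> together with \<open>\<P>\<close>; the four equivalences are the recursion in these terms.\<close>

section \<open>Players and moves\<close>

lemma opponent_neq [simp]: "opponent A \<noteq> A" "A \<noteq> opponent A"
  by (cases A; simp)+

lemma opponent_opponent [simp]: "opponent (opponent A) = A"
  by (cases A) simp_all

lemma eq_opponent_iff: "F = opponent A \<longleftrightarrow> F \<noteq> A"
  by (cases A; cases F) simp_all

lemma all_player_iff: "(\<forall>F. P F) \<longleftrightarrow> P A \<and> P (opponent A)"
  by (metis eq_opponent_iff)

lemma won_by_imp_no_moves: "won_by A T \<Longrightarrow> moves T = {||}"
  by (cases A) auto

lemma not_won_by_opponent: "won_by A T \<Longrightarrow> \<not> won_by (opponent A) T"
  by (cases A) auto

lemma position_moves: "position G \<Longrightarrow> H |\<in>| moves G \<Longrightarrow> position H"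
  by (auto elim: position.cases)

lemma position_no_moves_iff: "position G \<Longrightarrow> moves G = {||} \<longleftrightarrow> G \<in> {StarL, StarR}"
  by (auto elim: position.cases)

lemma position_moves_induct [consumes 1, case_names step]:
  assumes "position G"
    and step: "\<And>G. position G \<Longrightarrow> (\<And>H. H |\<in>| moves G \<Longrightarrow> P H) \<Longrightarrow> P G"
  shows "P G"
  using assms(1)
proof (induction rule: position.induct)
  case (3 Gs)
  then have "position (Node Gs)" by (intro position.intros)
  then show ?case by (rule step) (simp add: 3)
qed (rule step; simp add: position.intros)+

section \<open>Backward induction\<close>

inductive wins :: "player \<Rightarrow> player \<Rightarrow> game \<Rightarrow> bool" for A where
  terminal: "won_by A T \<Longrightarrow> wins A F T"
| own_move: "H |\<in>| moves G \<Longrightarrow> wins A (opponent A) H \<Longrightarrow> wins A A G"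
| opponent_move:
    "moves G \<noteq> {||} \<Longrightarrow> (\<And>H. H |\<in>| moves G \<Longrightarrow> wins A A H) \<Longrightarrow> wins A (opponent A) G"

lemma wins_terminal: "moves T = {||} \<Longrightarrow> wins A F T \<longleftrightarrow> won_by A T"
  by (auto elim: wins.cases intro: wins.terminal)

lemma wins_first:
  "moves G \<noteq> {||} \<Longrightarrow> wins A A G \<longleftrightarrow> (\<exists>H. H |\<in>| moves G \<and> wins A (opponent A) H)"
  by (subst wins.simps) (auto dest!: won_by_imp_no_moves)

lemma wins_second:
  "moves G \<noteq> {||} \<Longrightarrow> wins A (opponent A) G \<longleftrightarrow> (\<forall>H. H |\<in>| moves G \<longrightarrow> wins A A H)"
  by (subst wins.simps) (auto dest!: won_by_imp_no_moves)

lemma wins_opponent_iff: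
  assumes "position G"
  shows "wins (opponent A) F G \<longleftrightarrow> \<not> wins A F G"
  using assms
proof (induction arbitrary: F rule: position_moves_induct)
  case (step G)
  consider (terminal) "moves G = {||}" | (first) "moves G \<noteq> {||}" "F = A"
    | (second) "moves G \<noteq> {||}" "F = opponent A"
    using eq_opponent_iff by blast
  then show ?case
  proof cases
    case terminal
    with \<open>position G\<close> have "G \<in> {StarL, StarR}"
      by (simp add: position_no_moves_iff)
    with terminal show ?thesis
      by (cases A) (auto simp: wins_terminal)
  next
    case first
    with step.IH show ?thesis
      using wins_second[of G "opponent A"] by (auto simp: wins_first)
  next
    case second
    with step.IH show ?thesis
      by (auto simp: wins_first wins_second)
  qed
qed

section \<open>Plays and strategies\<close>

lemma complete_play_singleton: "complete_play G [H] \<longleftrightarrow> H = G \<and> G \<in> {StarL, StarR}"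
  by (auto simp: complete_play_def)

lemma complete_play_Cons_Cons:
  "complete_play G (G' # H # ps) \<longleftrightarrow> G' = G \<and> H |\<in>| moves G \<and> complete_play H (H # ps)"
  unfolding complete_play_def by (auto simp: nth_Cons split: nat.split)

lemma follows_singleton: "follows A F \<sigma> [H]"
  by (simp add: follows_def)

lemma follows_Cons_Cons:
  "follows A F \<sigma> (G # H # ps) \<longleftrightarrow> (F = A \<longrightarrow> H = \<sigma> G) \<and> follows A (opponent F) \<sigma> (H # ps)"
  unfolding follows_def by (auto simp: nth_Cons mover_def split: nat.split)

lemma ex_common_play:
  assumes "position G" "legal_strategy \<sigma>" "legal_strategy \<tau>"
  shows "\<exists>ps. complete_play G ps \<and> follows A F \<sigma> ps \<and> follows (opponent A) F \<tau> ps"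
  using assms(1)
proof (induction arbitrary: F rule: position_moves_induct)
  case (step G)
  show ?case
  proof (cases "moves G = {||}")
    case True
    with \<open>position G\<close> have "complete_play G [G]"
      by (simp add: complete_play_singleton position_no_moves_iff)
    then show ?thesis
      using follows_singleton by blast
  next
    case False
    define H where "H = (if F = A then \<sigma> G else \<tau> G)"
    have move: "H |\<in>| moves G"
      using False assms(2,3) by (simp add: H_def legal_strategy_def)
    with step.IH obtain ps where play: "complete_play H ps"
      and follows: "follows A (opponent F) \<sigma> ps" "follows (opponent A) (opponent F) \<tau> ps"
      by blast
    from play obtain qs where "ps = H # qs"
      by (cases ps) (auto simp: complete_play_def)
    with move play follows have "complete_play G (G # ps)"
      "follows A F \<sigma> (G # ps)" "follows (opponent A) F \<tau> (G # ps)"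
      by (auto simp: complete_play_Cons_Cons follows_Cons_Cons H_def)
    then show ?thesis by blast
  qed
qed

definition good_move :: "player \<Rightarrow> strategy" where
  "good_move A G = (SOME H. H |\<in>| moves G \<and> (wins A A G \<longrightarrow> wins A (opponent A) H))"

lemma
  assumes "moves G \<noteq> {||}"
  shows good_move_in_moves: "good_move A G |\<in>| moves G"
    and wins_good_move: "wins A A G \<Longrightarrow> wins A (opponent A) (good_move A G)"
proof -
  have "\<exists>H. H |\<in>| moves G \<and> (wins A A G \<longrightarrow> wins A (opponent A) H)"
    by (metis assms ex_fin_conv wins_first)
  then have "good_move A G |\<in>| moves G \<and> (wins A A G \<longrightarrow> wins A (opponent A) (good_move A G))"
    unfolding good_move_def by (rule someI_ex)
  then show "good_move A G |\<in>| moves G"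
    and "wins A A G \<Longrightarrow> wins A (opponent A) (good_move A G)"
    by blast+
qed

lemma legal_strategy_good_move: "legal_strategy (good_move A)"
  by (simp add: legal_strategy_def good_move_in_moves)

lemma won_by_last_if_follows_good_move:
  assumes "complete_play G ps" "follows A F (good_move A) ps" "wins A F G"
  shows "won_by A (last ps)"
  using assms
proof (induction ps arbitrary: G F rule: induct_list012)
  case 1
  then show ?case by (simp add: complete_play_def)
next
  case (2 G')
  then show ?case by (auto simp: complete_play_singleton wins_terminal)
next
  case (3 G' H ps)
  from \<open>complete_play G (G' # H # ps)\<close> have [simp]: "G' = G"
    and move: "H |\<in>| moves G" and play: "complete_play H (H # ps)"
    by (auto simp: complete_play_Cons_Cons)
  from \<open>follows A F (good_move A) (G' # H # ps)\<close> have own: "F = A \<Longrightarrow> H = good_move A G"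
    and follows: "follows A (opponent F) (good_move A) (H # ps)"
    by (auto simp: follows_Cons_Cons)
  from move have has_moves: "moves G \<noteq> {||}" by auto
  have "wins A (opponent F) H"
  proof (cases "F = A")
    case True
    with own \<open>wins A F G\<close> has_moves show ?thesis
      by (simp add: wins_good_move)
  next
    case False
    then have "F = opponent A" by (simp add: eq_opponent_iff)
    with \<open>wins A F G\<close> has_moves move show ?thesis
      by (simp add: wins_second)
  qed
  with "3.IH"(2) play follows show ?case by simp
qed

lemma has_winning_strategy_if_wins: "wins A F G \<Longrightarrow> has_winning_strategy A F G"
  unfolding has_winning_strategy_def
  using legal_strategy_good_move won_by_last_if_follows_good_move by blast

lemma not_has_winning_strategy_opponent:
  assumes "position G" "has_winning_strategy A F G"
  shows "\<not> has_winning_strategy (opponent A) F G"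
proof
  assume "has_winning_strategy (opponent A) F G"
  with assms obtain ps where "won_by A (last ps)" "won_by (opponent A) (last ps)"
    unfolding has_winning_strategy_def using ex_common_play by meson
  then show False by (simp add: not_won_by_opponent)
qed

lemma has_winning_strategy_iff_wins:
  "position G \<Longrightarrow> has_winning_strategy A F G \<longleftrightarrow> wins A F G"
  using has_winning_strategy_if_wins not_has_winning_strategy_opponent wins_opponent_iff by blast

lemma has_winning_strategy_opponent_iff:
  "position G \<Longrightarrow> has_winning_strategy (opponent A) F G \<longleftrightarrow> \<not> has_winning_strategy A F G"
  by (simp add: has_winning_strategy_iff_wins wins_opponent_iff)

lemma has_winning_strategy_terminal:
  "position T \<Longrightarrow> moves T = {||} \<Longrightarrow> has_winning_strategy A F T \<longleftrightarrow> won_by A T"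
  by (simp add: has_winning_strategy_iff_wins wins_terminal)

lemma has_winning_strategy_first:
  assumes "position G" "moves G \<noteq> {||}"
  shows "has_winning_strategy A A G \<longleftrightarrow>
    (\<exists>H. H |\<in>| moves G \<and> has_winning_strategy A (opponent A) H)"
  using assms position_moves[OF assms(1)]
  by (auto simp: has_winning_strategy_iff_wins wins_first)

lemma has_winning_strategy_second:
  assumes "position G" "moves G \<noteq> {||}"
  shows "has_winning_strategy A (opponent A) G \<longleftrightarrow>
    (\<forall>H. H |\<in>| moves G \<longrightarrow> has_winning_strategy A A H)"
  using assms position_moves[OF assms(1)]
  by (auto simp: has_winning_strategy_iff_wins wins_second)

section \<open>Outcome classes\<close>

definition outcome_for :: "player \<Rightarrow> game set" where
  "outcome_for A = {G. position G \<and> (\<forall>F. has_winning_strategy A F G)}"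

lemma outcome_L_eq: "outcome_L = outcome_for Left"
  by (simp add: outcome_L_def outcome_for_def)

lemma outcome_R_eq: "outcome_R = outcome_for Right"
  by (simp add: outcome_R_def outcome_for_def)

lemma outcome_for_iff:
  assumes "position G"
  shows "G \<in> outcome_for A \<longleftrightarrow>
    has_winning_strategy A A G \<and> has_winning_strategy A (opponent A) G"
  using assms by (simp add: outcome_for_def all_player_iff[where A = A])

lemma outcome_N_iff:
  assumes "position G"
  shows "G \<in> outcome_N \<longleftrightarrow>
    has_winning_strategy A A G \<and> \<not> has_winning_strategy A (opponent A) G"
  using assms
  by (simp add: outcome_N_def all_player_iff[where A = A] has_winning_strategy_opponent_iff)

lemma outcome_P_iff:
  assumes "position G"
  shows "G \<in> outcome_P \<longleftrightarrow>
    \<not> has_winning_strategy A A G \<and> has_winning_strategy A (opponent A) G"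
  using assms
  by (auto simp: outcome_P_def all_player_iff[where A = A] has_winning_strategy_opponent_iff)

lemma outcome_for_Un_N_iff:
  "position G \<Longrightarrow> G \<in> outcome_for A \<union> outcome_N \<longleftrightarrow> has_winning_strategy A A G"
  by (auto simp: outcome_for_iff outcome_N_iff[where A = A])

lemma outcome_for_Un_P_iff:
  "position G \<Longrightarrow> G \<in> outcome_for A \<union> outcome_P \<longleftrightarrow> has_winning_strategy A (opponent A) G"
  by (auto simp: outcome_for_iff outcome_P_iff[where A = A])

lemma terminal_in_outcome_for_iff:
  "position T \<Longrightarrow> moves T = {||} \<Longrightarrow> T \<in> outcome_for A \<longleftrightarrow> won_by A T"
  by (simp add: outcome_for_iff has_winning_strategy_terminal)

context
  fixes G :: game
  assumes position: "position G" and has_moves: "moves G \<noteq> {||}"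
begin

lemma first_wins_iff_moves:
  "has_winning_strategy A A G \<longleftrightarrow> (\<exists>H. H |\<in>| moves G \<and> H \<in> outcome_for A \<union> outcome_P)"
  using has_winning_strategy_first[OF position has_moves]
    outcome_for_Un_P_iff[OF position_moves[OF position]] by blast

lemma second_wins_iff_moves:
  "has_winning_strategy A (opponent A) G \<longleftrightarrow>
    (\<forall>H. H |\<in>| moves G \<longrightarrow> H \<in> outcome_for A \<union> outcome_N)"
  using has_winning_strategy_second[OF position has_moves]
    outcome_for_Un_N_iff[OF position_moves[OF position]] by blast

lemma outcome_N_iff_moves:
  "G \<in> outcome_N \<longleftrightarrow> (\<forall>A. \<exists>H. H |\<in>| moves G \<and> H \<in> outcome_for A \<union> outcome_P)"
  using position by (simp add: outcome_N_def first_wins_iff_moves)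

lemma outcome_P_iff_moves:
  "G \<in> outcome_P \<longleftrightarrow> (\<forall>H. H |\<in>| moves G \<longrightarrow> H \<in> outcome_N)"
proof -
  have "G \<in> outcome_P \<longleftrightarrow> (\<forall>A. has_winning_strategy A (opponent A) G)"
    using position by (auto simp: outcome_P_def all_player_iff[where A = Left])
  also have "\<dots> \<longleftrightarrow> (\<forall>H. H |\<in>| moves G \<longrightarrow> (\<forall>A. has_winning_strategy A A H))"
    using has_winning_strategy_second[OF position has_moves] by blast
  also have "\<dots> \<longleftrightarrow> (\<forall>H. H |\<in>| moves G \<longrightarrow> H \<in> outcome_N)"
    using position_moves[OF position] by (auto simp: outcome_N_def)
  finally show ?thesis .
qed

lemma outcome_for_iff_moves:
  "G \<in> outcome_for A \<longleftrightarrow>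
    (\<exists>H. H |\<in>| moves G \<and> H \<in> outcome_for A) \<and>
    (\<forall>H. H |\<in>| moves G \<longrightarrow> H \<in> outcome_for A \<union> outcome_N)"
proof -
  have "H \<notin> outcome_P" if "H |\<in>| moves G" "H \<in> outcome_for A \<union> outcome_N" for H
    using that position_moves[OF position]
    by (simp add: outcome_for_Un_N_iff outcome_P_iff[where A = A] del: Un_iff)
  then show ?thesis
    unfolding outcome_for_iff[OF position] first_wins_iff_moves second_wins_iff_moves
    by blast
qed

end

theorem theorem2p8:
  shows "StarL \<in> outcome_L \<and> StarR \<in> outcome_R \<and>
    (\<forall>Gs. position (Node Gs) \<longrightarrow>
      (((\<exists>H. H |\<in>| Gs \<and> H \<in> outcome_L \<union> outcome_P) \<and>
        (\<exists>K. K |\<in>| Gs \<and> K \<in> outcome_R \<union> outcome_P)) \<longleftrightarrow> Node Gs \<in> outcome_N) \<and>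
      (((\<exists>H. H |\<in>| Gs \<and> H \<in> outcome_L) \<and>
        (\<forall>K. K |\<in>| Gs \<longrightarrow> K \<in> outcome_L \<union> outcome_N)) \<longleftrightarrow> Node Gs \<in> outcome_L) \<and>
      (((\<exists>H. H |\<in>| Gs \<and> H \<in> outcome_R) \<and>
        (\<forall>K. K |\<in>| Gs \<longrightarrow> K \<in> outcome_R \<union> outcome_N)) \<longleftrightarrow> Node Gs \<in> outcome_R) \<and>
      ((\<forall>H. H |\<in>| Gs \<longrightarrow> H \<in> outcome_N) \<longleftrightarrow> Node Gs \<in> outcome_P))"
proof (intro conjI allI impI)
  show "StarL \<in> outcome_L" "StarR \<in> outcome_R"
    by (simp_all add: outcome_L_eq outcome_R_eq terminal_in_outcome_for_iff position.intros)
next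
  fix Gs
  assume position: "position (Node Gs)"
  then have has_moves: "moves (Node Gs) \<noteq> {||}"
    by (simp add: position_no_moves_iff del: moves.simps)
  note by_moves = outcome_N_iff_moves[OF position has_moves]
    outcome_for_iff_moves[OF position has_moves] outcome_P_iff_moves[OF position has_moves]
  show "((\<exists>H. H |\<in>| Gs \<and> H \<in> outcome_L \<union> outcome_P) \<and>
      (\<exists>K. K |\<in>| Gs \<and> K \<in> outcome_R \<union> outcome_P)) \<longleftrightarrow> Node Gs \<in> outcome_N"
    by (simp add: by_moves outcome_L_eq outcome_R_eq all_player_iff[where A = Left])
  show "((\<exists>H. H |\<in>| Gs \<and> H \<in> outcome_L) \<and>
      (\<forall>K. K |\<in>| Gs \<longrightarrow> K \<in> outcome_L \<union> outcome_N)) \<longleftrightarrow> Node Gs \<in> outcome_L"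
    and "((\<exists>H. H |\<in>| Gs \<and> H \<in> outcome_R) \<and>
      (\<forall>K. K |\<in>| Gs \<longrightarrow> K \<in> outcome_R \<union> outcome_N)) \<longleftrightarrow> Node Gs \<in> outcome_R"
    and "(\<forall>H. H |\<in>| Gs \<longrightarrow> H \<in> outcome_N) \<longleftrightarrow> Node Gs \<in> outcome_P"
    using by_moves by (simp_all add: outcome_L_eq outcome_R_eq)
qed

end
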